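(* Let $(\mathcal A,\circ)$ be a mock-Novikov algebra (that is, a $\delta$-mock-Novikov algebra with $\delta=1$) over a field of characteristic zero. Define $[x,y]=x\circ y-y\circ x$ for $x,y\in\mathcal A$. Then $(\mathcal A,[-,-])$ is a Malcev algebra.
   Context: An algebra is a vector space with a bilinear product, not necessarily associative, of arbitrary dimension. A mock-Novikov algebra is an algebra $(\mathcal A,\circ)$ satisfying, for all $a,b,c\in\mathcal A$, $$(a\circ b)\circ c+(b\circ a)\circ c+a\circ(b\circ c)+b\circ(a\circ c)=0,\qquad (a\circ b)\circ c+(a\circ c)\circ b=0.$$ An anti-commutative algebra $(\mathcal M,[-,-])$ (i.e. $[x,y]=-[y,x]$) is a Malcev algebra if for all $x,y,z\in\mathcal M$ $$J(x,y,[x,z])=[J(x,y,z),x],\qquad\text{where } J(x,y,z)=[[x,y],z]+[[y,z],x]+[[z,x],y].$$ *)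

theory Defs
  imports Complex_Main
begin

text \<open>
  No associativity, unit or finite-dimensionality is assumed of the product. The ground field
  is a type parameter; assumptions on its characteristic are imposed through its type class.
\<close>

locale nonassoc_algebra = vector_space scale
  for scale :: "'k::field \<Rightarrow> 'a::ab_group_add \<Rightarrow> 'a" +
  fixes mult :: "'a \<Rightarrow> 'a \<Rightarrow> 'a"
  assumes linear_left: "Vector_Spaces.linear scale scale (\<lambda>x. mult x y)"
    and linear_right: "Vector_Spaces.linear scale scale (\<lambda>y. mult x y)"

locale mock_novikov_algebra = nonassoc_algebra scale mult
  for scale :: "'k::field \<Rightarrow> 'a::ab_group_add \<Rightarrow> 'a"
    and mult :: "'a \<Rightarrow> 'a \<Rightarrow> 'a" (infixl \<open>\<circ>\<^sub>A\<close> 70) +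
  assumes mock_left_symmetric:
      "(a \<circ>\<^sub>A b) \<circ>\<^sub>A c + (b \<circ>\<^sub>A a) \<circ>\<^sub>A c + a \<circ>\<^sub>A (b \<circ>\<^sub>A c) + b \<circ>\<^sub>A (a \<circ>\<^sub>A c) = 0"
    and mock_right_commutative:
      "(a \<circ>\<^sub>A b) \<circ>\<^sub>A c + (a \<circ>\<^sub>A c) \<circ>\<^sub>A b = 0"

locale anticommutative_algebra = nonassoc_algebra scale bracket
  for scale :: "'k::field \<Rightarrow> 'a::ab_group_add \<Rightarrow> 'a"
    and bracket :: "'a \<Rightarrow> 'a \<Rightarrow> 'a" +
  assumes anticommute: "bracket x y = - bracket y x"

definition jacobian :: "('a \<Rightarrow> 'a \<Rightarrow> 'a) \<Rightarrow> 'a \<Rightarrow> 'a \<Rightarrow> 'a \<Rightarrow> 'a::ab_group_add" where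
  "jacobian bracket x y z =
     bracket (bracket x y) z + bracket (bracket y z) x + bracket (bracket z x) y"

locale malcev_algebra = anticommutative_algebra scale bracket
  for scale :: "'k::field \<Rightarrow> 'a::ab_group_add \<Rightarrow> 'a"
    and bracket :: "'a \<Rightarrow> 'a \<Rightarrow> 'a" +
  assumes malcev_identity:
    "jacobian bracket x y (bracket x z) = bracket (jacobian bracket x y z) x"

definition commutator :: "('a \<Rightarrow> 'a \<Rightarrow> 'a) \<Rightarrow> 'a \<Rightarrow> 'a \<Rightarrow> 'a::ab_group_add" where
  "commutator mult x y = mult x y - mult y x"

end

theory Submission
  imports Defs
begin

text \<open>
  Write \<open>L\<^sub>a u = a u\<close>, \<open>R\<^sub>a u = u a\<close>. The axioms express \<open>L\<^sub>a\<^sub>b\<close> and \<open>R\<^sub>a\<^sub>b\<close> through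
  \<open>L\<^sub>a, L\<^sub>b, R\<^sub>a, R\<^sub>b\<close>, and they give \<open>R\<^sub>a R\<^sub>b = - R\<^sub>b R\<^sub>a\<close> and
  \<open>R\<^sub>a L\<^sub>b + R\<^sub>b L\<^sub>a = L\<^sub>a L\<^sub>b + L\<^sub>b L\<^sub>a\<close>. Hence \<open>J(x,y,_) = 2 E\<close> with
  \<open>E = L\<^sub>x R\<^sub>y - L\<^sub>y R\<^sub>x + L\<^sub>y L\<^sub>x - R\<^sub>y L\<^sub>x - 2 R\<^sub>x R\<^sub>y\<close>, and the Malcev identity says that \<open>E\<close>
  anticommutes with \<open>L\<^sub>x - R\<^sub>x\<close>. This reduces to
  \<open>L\<^sub>y L\<^sub>x L\<^sub>x + R\<^sub>x R\<^sub>y L\<^sub>x + L\<^sub>x R\<^sub>x R\<^sub>y = 0\<close>. Applying the axioms to products yields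
  \<open>L\<^sub>x R\<^sub>x R\<^sub>y = R\<^sub>x R\<^sub>y L\<^sub>x\<close> and \<open>L\<^sub>y L\<^sub>x L\<^sub>x = - 2 R\<^sub>x R\<^sub>y L\<^sub>x\<close>. Only division by 2 is needed.
\<close>

context nonassoc_algebra
begin

lemma mult_add_left: "mult (x + y) z = mult x z + mult y z"
  using linear_left[of z] by (simp add: Vector_Spaces.linear_iff)

lemma mult_add_right: "mult z (x + y) = mult z x + mult z y"
  using linear_right[of z] by (simp add: Vector_Spaces.linear_iff)

lemma mult_minus_left: "mult (- x) z = - mult x z"
  using mult_add_left[of x "- x" z] mult_add_left[of 0 0 z] by (simp add: eq_neg_iff_add_eq_0 add.commute)

lemma mult_minus_right: "mult z (- x) = - mult z x"
  using mult_add_right[of z x "- x"] mult_add_right[of z 0 0] by (simp add: eq_neg_iff_add_eq_0 add.commute)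

lemma mult_zero_left: "mult 0 z = 0"
  using mult_add_left[of 0 0 z] by simp

lemma mult_zero_right: "mult z 0 = 0"
  using mult_add_right[of z 0 0] by simp

lemma mult_diff_left: "mult (x - y) z = mult x z - mult y z"
  using mult_add_left[of x "- y" z] by (simp add: mult_minus_left)

lemma mult_diff_right: "mult z (x - y) = mult z x - mult z y"
  using mult_add_right[of z x "- y"] by (simp add: mult_minus_right)

lemmas mult_simps = mult_add_left mult_add_right mult_minus_left mult_minus_right
  mult_zero_left mult_zero_right mult_diff_left mult_diff_right

lemma nonassoc_algebra_commutator: "nonassoc_algebra scale (commutator mult)"
proof -
  have sl: "mult (scale c x) y = scale c (mult x y)" for c x y
    using linear_left[of y] by (simp add: Vector_Spaces.linear_iff)
  have sr: "mult y (scale c x) = scale c (mult y x)" for c x y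
    using linear_right[of y] by (simp add: Vector_Spaces.linear_iff)
  show ?thesis
    by unfold_locales
      (simp_all add: commutator_def mult_simps sl sr scale_right_diff_distrib)
qed

end

locale mock_novikov_algebra_char_not_2 = mock_novikov_algebra scale mult
  for scale :: "'k::field \<Rightarrow> 'a::ab_group_add \<Rightarrow> 'a"
    and mult :: "'a \<Rightarrow> 'a \<Rightarrow> 'a" (infixl \<open>\<circ>\<^sub>A\<close> 70) +
  assumes two_neq_zero: "(2::'k) \<noteq> 0"
begin

lemma double_eq_zero:
  fixes u :: 'a
  assumes "u + u = 0" shows "u = 0"
proof -
  have "scale 2 u = u + u"
    using scale_left_distrib[of 1 1 u] by simp
  with assms two_neq_zero show ?thesis
    by simp
qed

lemma right_anticommute: "a \<circ>\<^sub>A b \<circ>\<^sub>A c = - (a \<circ>\<^sub>A c \<circ>\<^sub>A b)"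
  using mock_right_commutative[of a b c] by (simp add: eq_neg_iff_add_eq_0)

lemma right_square_zero: "a \<circ>\<^sub>A b \<circ>\<^sub>A b = 0"
  using mock_right_commutative double_eq_zero by blast

text \<open>The first axiom solved for right multiplication by a product. The right side contains
  a(uc), of the same shape, so as an unrestricted rewrite rule it would loop; hence the explicit
  instances.\<close>

lemma mult_product:
  "u \<circ>\<^sub>A (a \<circ>\<^sub>A c) = - (a \<circ>\<^sub>A u \<circ>\<^sub>A c) - u \<circ>\<^sub>A a \<circ>\<^sub>A c - a \<circ>\<^sub>A (u \<circ>\<^sub>A c)"
  using mock_left_symmetric[of a u c] by (simp add: algebra_simps eq_neg_iff_add_eq_0 neg_eq_iff_add_eq_0)

text \<open>In the first axiom, (xy)u and (yx)u become -(xu)y and -(yu)x by the second.\<close>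

lemma left_anticommutator:
  "x \<circ>\<^sub>A u \<circ>\<^sub>A y + y \<circ>\<^sub>A u \<circ>\<^sub>A x = x \<circ>\<^sub>A (y \<circ>\<^sub>A u) + y \<circ>\<^sub>A (x \<circ>\<^sub>A u)"
  using mock_left_symmetric[of x y u]
  by (simp add: right_anticommute[of x u y] right_anticommute[of y u x] algebra_simps eq_neg_iff_add_eq_0 neg_eq_iff_add_eq_0)

lemma left_square: "x \<circ>\<^sub>A u \<circ>\<^sub>A x = x \<circ>\<^sub>A (x \<circ>\<^sub>A u)"
proof -
  have "(x \<circ>\<^sub>A u \<circ>\<^sub>A x - x \<circ>\<^sub>A (x \<circ>\<^sub>A u)) + (x \<circ>\<^sub>A u \<circ>\<^sub>A x - x \<circ>\<^sub>A (x \<circ>\<^sub>A u)) = 0"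
    using left_anticommutator[of x u x] by (simp add: algebra_simps)
  from double_eq_zero[OF this] show ?thesis by simp
qed

text \<open>By the second axiom u((ab)c) changes sign when b and c are swapped. In its expansion all
  other terms do so too, except for the pair (a(ub))c + (a(uc))b, which is symmetric. So twice this
  pair vanishes.\<close>

lemma right_left_right_anticommute: "a \<circ>\<^sub>A (u \<circ>\<^sub>A b) \<circ>\<^sub>A c = - (a \<circ>\<^sub>A (u \<circ>\<^sub>A c) \<circ>\<^sub>A b)"
proof -
  have expand: "u \<circ>\<^sub>A (a \<circ>\<^sub>A b \<circ>\<^sub>A c) = a \<circ>\<^sub>A u \<circ>\<^sub>A b \<circ>\<^sub>A c + a \<circ>\<^sub>A u \<circ>\<^sub>A b \<circ>\<^sub>A c + u \<circ>\<^sub>A a \<circ>\<^sub>A b \<circ>\<^sub>A c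
      + a \<circ>\<^sub>A (u \<circ>\<^sub>A b) \<circ>\<^sub>A c + a \<circ>\<^sub>A (u \<circ>\<^sub>A c) \<circ>\<^sub>A b" for b c
    unfolding mult_product[of u "a \<circ>\<^sub>A b" c] right_anticommute[of a b u]
      mult_product[of u a b] right_anticommute[of a b "u \<circ>\<^sub>A c"]
    by (simp add: mult_simps algebra_simps)
  let ?s = "a \<circ>\<^sub>A (u \<circ>\<^sub>A b) \<circ>\<^sub>A c + a \<circ>\<^sub>A (u \<circ>\<^sub>A c) \<circ>\<^sub>A b"
  have "u \<circ>\<^sub>A (a \<circ>\<^sub>A b \<circ>\<^sub>A c) + u \<circ>\<^sub>A (a \<circ>\<^sub>A c \<circ>\<^sub>A b) = 0"
    by (subst right_anticommute[of a b c]) (simp add: mult_simps)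
  then have "?s + ?s = 0"
    unfolding expand right_anticommute[of "a \<circ>\<^sub>A u" b c] right_anticommute[of "u \<circ>\<^sub>A a" b c]
    by (simp add: algebra_simps)
  from double_eq_zero[OF this] show ?thesis
    by (simp add: eq_neg_iff_add_eq_0)
qed

text \<open>Apply the second axiom to u, y and xx, then expand both products by xx. The terms
  (x(uy))x and (x(ux))y cancel by the preceding lemma.\<close>

lemma left_right_right: "x \<circ>\<^sub>A (u \<circ>\<^sub>A y \<circ>\<^sub>A x) = x \<circ>\<^sub>A u \<circ>\<^sub>A y \<circ>\<^sub>A x"
proof -
  have "u \<circ>\<^sub>A y \<circ>\<^sub>A (x \<circ>\<^sub>A x) + u \<circ>\<^sub>A (x \<circ>\<^sub>A x) \<circ>\<^sub>A y = 0"
    by (rule mock_right_commutative)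
  then show ?thesis
    unfolding mult_product[of "u \<circ>\<^sub>A y" x x] mult_product[of u x x]
    by (simp add: mult_simps right_square_zero right_left_right_anticommute[of x u y x]
        right_anticommute[of "x \<circ>\<^sub>A u" x y] algebra_simps)
qed

text \<open>Two linear relations determine \<open>?q\<close>: \<open>B\<close> gives q + p = r, and
  the first axiom for x, y, x multiplied on the right by u gives q + r + 3p = 0. Eliminating r
  yields 2q = -4p.\<close>

lemma left_left_left:
  "y \<circ>\<^sub>A (x \<circ>\<^sub>A (x \<circ>\<^sub>A u)) = - (x \<circ>\<^sub>A u \<circ>\<^sub>A y \<circ>\<^sub>A x) - x \<circ>\<^sub>A u \<circ>\<^sub>A y \<circ>\<^sub>A x"
proof -
  let ?p = "x \<circ>\<^sub>A u \<circ>\<^sub>A y \<circ>\<^sub>A x" and ?q = "y \<circ>\<^sub>A (x \<circ>\<^sub>A (x \<circ>\<^sub>A u))" and ?r = "x \<circ>\<^sub>A (y \<circ>\<^sub>A u \<circ>\<^sub>A x)"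
  have B: "?q + ?p = ?r"
    using left_anticommutator[of x u "y \<circ>\<^sub>A x"]
    unfolding mult_product[of "x \<circ>\<^sub>A u" y x] right_anticommute[of y x u]
      right_anticommute[of y x "x \<circ>\<^sub>A u"]
    by (simp add: mult_simps right_square_zero left_square algebra_simps)
  \<comment> \<open>Right multiplication by x kills (yu)x, so only p survives on the left.\<close>
  have p: "x \<circ>\<^sub>A (y \<circ>\<^sub>A u) \<circ>\<^sub>A x + y \<circ>\<^sub>A (x \<circ>\<^sub>A u) \<circ>\<^sub>A x = ?p"
    using arg_cong[OF left_anticommutator[of x u y], of "\<lambda>t. t \<circ>\<^sub>A x"]
    by (simp add: mult_simps right_square_zero)
  have xy: "x \<circ>\<^sub>A y \<circ>\<^sub>A x \<circ>\<^sub>A u + y \<circ>\<^sub>A x \<circ>\<^sub>A x \<circ>\<^sub>A u = ?p"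
  proof -
    have "x \<circ>\<^sub>A y \<circ>\<^sub>A x \<circ>\<^sub>A u + y \<circ>\<^sub>A x \<circ>\<^sub>A x \<circ>\<^sub>A u = - ((x \<circ>\<^sub>A y \<circ>\<^sub>A u + y \<circ>\<^sub>A x \<circ>\<^sub>A u) \<circ>\<^sub>A x)"
      by (simp add: mult_simps right_anticommute[of _ x u])
    also have "x \<circ>\<^sub>A y \<circ>\<^sub>A u + y \<circ>\<^sub>A x \<circ>\<^sub>A u = - (x \<circ>\<^sub>A u \<circ>\<^sub>A y) - y \<circ>\<^sub>A u \<circ>\<^sub>A x"
      by (simp add: right_anticommute[of x y u] right_anticommute[of y x u])
    finally show ?thesis
      by (simp add: mult_simps right_square_zero)
  qed
  have x_yx: "x \<circ>\<^sub>A (y \<circ>\<^sub>A x) \<circ>\<^sub>A u = y \<circ>\<^sub>A (x \<circ>\<^sub>A u) \<circ>\<^sub>A x + ?p + ?q"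
    unfolding right_anticommute[of x "y \<circ>\<^sub>A x" u] mult_product[of "x \<circ>\<^sub>A u" y x]
    by (simp add: left_square)
  have y_xx: "y \<circ>\<^sub>A (x \<circ>\<^sub>A x) \<circ>\<^sub>A u = x \<circ>\<^sub>A (y \<circ>\<^sub>A u) \<circ>\<^sub>A x + ?r"
    unfolding right_anticommute[of y "x \<circ>\<^sub>A x" u] mult_product[of "y \<circ>\<^sub>A u" x x]
    by (simp add: right_square_zero)
  have "x \<circ>\<^sub>A y \<circ>\<^sub>A x \<circ>\<^sub>A u + y \<circ>\<^sub>A x \<circ>\<^sub>A x \<circ>\<^sub>A u + x \<circ>\<^sub>A (y \<circ>\<^sub>A x) \<circ>\<^sub>A u + y \<circ>\<^sub>A (x \<circ>\<^sub>A x) \<circ>\<^sub>A u = 0"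
    using arg_cong[OF mock_left_symmetric[of x y x], of "\<lambda>t. t \<circ>\<^sub>A u"] by (simp add: mult_simps)
  then have "?p + (x \<circ>\<^sub>A (y \<circ>\<^sub>A u) \<circ>\<^sub>A x + y \<circ>\<^sub>A (x \<circ>\<^sub>A u) \<circ>\<^sub>A x) + ?p + ?q + ?r = 0"
    unfolding xy x_yx y_xx by (simp add: algebra_simps)
  then have "(?q + ?p + ?p) + (?q + ?p + ?p) = 0"
    unfolding p B[symmetric] by (simp add: algebra_simps)
  from double_eq_zero[OF this] show ?thesis
    by (simp add: algebra_simps eq_neg_iff_add_eq_0 neg_eq_iff_add_eq_0)
qed

text \<open>This is E applied to u. Repeating the last term in place of a scalar 2 keeps the
  computations within addition and \<open>mult\<close>.\<close>

definition half_jacobian :: "'a \<Rightarrow> 'a \<Rightarrow> 'a \<Rightarrow> 'a" where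
  "half_jacobian x y u = x \<circ>\<^sub>A (u \<circ>\<^sub>A y) - y \<circ>\<^sub>A (u \<circ>\<^sub>A x) + y \<circ>\<^sub>A (x \<circ>\<^sub>A u) - x \<circ>\<^sub>A u \<circ>\<^sub>A y
    - u \<circ>\<^sub>A y \<circ>\<^sub>A x - u \<circ>\<^sub>A y \<circ>\<^sub>A x"

lemma jacobian_commutator:
  "jacobian (commutator mult) x y u = half_jacobian x y u + half_jacobian x y u"
proof -
  \<comment> \<open>Eliminating (yu)x leaves only the monomials of \<open>half_jacobian\<close> and
    x(yu), which cancels.\<close>
  have yux: "y \<circ>\<^sub>A u \<circ>\<^sub>A x = x \<circ>\<^sub>A (y \<circ>\<^sub>A u) + y \<circ>\<^sub>A (x \<circ>\<^sub>A u) - x \<circ>\<^sub>A u \<circ>\<^sub>A y"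
    using left_anticommutator[of x u y] by (simp add: algebra_simps)
  show ?thesis
    unfolding jacobian_def commutator_def half_jacobian_def mult_simps
      mult_product[of u x y] mult_product[of u y x]
      right_anticommute[of x y u] right_anticommute[of y x u] right_anticommute[of u x y] yux
    by (simp add: algebra_simps)
qed

lemma half_jacobian_anticommute:
  "half_jacobian x y (commutator mult x u) = commutator mult (half_jacobian x y u) x"
proof -
  \<comment> \<open>This and the next two facts eliminate the words
    \<open>R\<^sub>x L\<^sub>y R\<^sub>x\<close>, \<open>R\<^sub>y L\<^sub>x L\<^sub>x\<close> and
    \<open>R\<^sub>x L\<^sub>y L\<^sub>x\<close>, so that both sides can be compared word by
    word.\<close>
  have mixed: "y \<circ>\<^sub>A (u \<circ>\<^sub>A x) \<circ>\<^sub>A x = x \<circ>\<^sub>A (y \<circ>\<^sub>A (u \<circ>\<^sub>A x)) + y \<circ>\<^sub>A (x \<circ>\<^sub>A (u \<circ>\<^sub>A x)) - x \<circ>\<^sub>A (u \<circ>\<^sub>A x) \<circ>\<^sub>A y"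
    using left_anticommutator[of x "u \<circ>\<^sub>A x" y] by (simp add: algebra_simps)
  have xxy: "x \<circ>\<^sub>A (x \<circ>\<^sub>A u) \<circ>\<^sub>A y = - (x \<circ>\<^sub>A u \<circ>\<^sub>A y \<circ>\<^sub>A x)"
    unfolding left_square[symmetric] by (rule right_anticommute)
  have yxx: "y \<circ>\<^sub>A (x \<circ>\<^sub>A u) \<circ>\<^sub>A x = x \<circ>\<^sub>A (y \<circ>\<^sub>A (x \<circ>\<^sub>A u)) - x \<circ>\<^sub>A u \<circ>\<^sub>A y \<circ>\<^sub>A x"
    using left_anticommutator[of x "x \<circ>\<^sub>A u" y] by (simp add: xxy left_left_left algebra_simps)
  have "u \<circ>\<^sub>A x \<circ>\<^sub>A y \<circ>\<^sub>A x = 0"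
    by (simp add: right_anticommute[of u x y] mult_simps right_square_zero)
  moreover have "x \<circ>\<^sub>A (u \<circ>\<^sub>A x \<circ>\<^sub>A y) = - (x \<circ>\<^sub>A u \<circ>\<^sub>A y \<circ>\<^sub>A x)"
    by (simp add: right_anticommute[of u x y] mult_simps left_right_right)
  ultimately show ?thesis
    by (simp add: half_jacobian_def commutator_def mult_simps right_square_zero left_square
        mixed xxy yxx left_right_right left_left_left algebra_simps)
qed

lemma malcev_algebra_commutator: "malcev_algebra scale (commutator mult)"
proof -
  interpret comm: nonassoc_algebra scale "commutator mult"
    by (rule nonassoc_algebra_commutator)
  show ?thesis
  proof
    show "commutator mult x y = - commutator mult y x" for x y
      by (simp add: commutator_def)
    show "jacobian (commutator mult) x y (commutator mult x z) =
        commutator mult (jacobian (commutator mult) x y z) x" for x y z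
      by (simp add: jacobian_commutator half_jacobian_anticommute comm.mult_add_left)
  qed
qed

end

theorem proposition2p6:
  fixes scale :: "'k::field_char_0 \<Rightarrow> 'a::ab_group_add \<Rightarrow> 'a"
    and mult :: "'a \<Rightarrow> 'a \<Rightarrow> 'a"
  assumes "mock_novikov_algebra scale mult"
  shows "malcev_algebra scale (commutator mult)"
proof -
  interpret mock_novikov_algebra scale mult
    by (rule assms)
  interpret mock_novikov_algebra_char_not_2 scale mult
    by unfold_locales simp
  show ?thesis
    by (rule malcev_algebra_commutator)
qed

end
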